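(* Let $r\ge 1$ and let $h_1,\dots,h_r$ be pairwise distinct positive real numbers. Then the linear system $$\sum_{i=1}^r c_i=1,\qquad \sum_{i=1}^r c_i\,h_i^{2k}=0\quad\text{for } k=1,\dots,r-1,$$ in the unknowns $c_1,\dots,c_r\in\mathbb{R}$ has the unique solution $$c_i=\prod_{\substack{j=1\\ j\ne i}}^r\frac{-h_j^2}{h_i^2-h_j^2},\qquad i=1,\dots,r.$$
   Context: The $c_i$ are the weights of the order-$r$ Richardson extrapolation of an estimator depending on a bandwidth $h$ whose bias expands in even powers of $h$. An empty product equals $1$. *)

theory Defs
  imports Complex_Main
begin

end

theory Submission
  imports Defs "HOL-Computational_Algebra.Polynomial"
begin

text \<open>With \<open>x\<^sub>i = h\<^sub>i\<^sup>2\<close>, the system says that the functional \<open>p \<mapsto> \<Sum>\<^sub>i c\<^sub>i p(x\<^sub>i)\<close> agrees with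
  evaluation at \<open>0\<close> on all polynomials of degree less than \<open>r\<close>. Testing it on the Lagrange basis
  polynomials of the nodes \<open>x\<^sub>i\<close> shows that \<open>c\<^sub>i\<close> must be the value at \<open>0\<close> of the \<open>i\<close>-th one, and
  Lagrange interpolation shows that these values are indeed a solution.\<close>

definition lagrange_basis :: "'i set \<Rightarrow> ('i \<Rightarrow> 'a::field) \<Rightarrow> 'i \<Rightarrow> 'a poly" where
  "lagrange_basis I x i = (\<Prod>j\<in>I - {i}. smult (inverse (x i - x j)) [:- x j, 1:])"

lemma poly_lagrange_basis:
  "poly (lagrange_basis I x i) y = (\<Prod>j\<in>I - {i}. (y - x j) / (x i - x j))"
  by (simp add: lagrange_basis_def poly_prod divide_inverse algebra_simps)

lemma poly_lagrange_basis_node: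
  assumes "finite I" "inj_on x I" "i \<in> I" "k \<in> I"
  shows "poly (lagrange_basis I x i) (x k) = (if k = i then 1 else 0)"
proof (cases "k = i")
  case True
  have "x i - x j \<noteq> 0" if "j \<in> I - {i}" for j
    using assms that by (auto dest: inj_onD)
  then show ?thesis
    using True by (simp add: poly_lagrange_basis)
next
  case False
  \<comment> \<open>The factor with index \<open>k\<close> vanishes at \<open>x k\<close>, hence the
    witness \<open>k\<close>.\<close>
  then show ?thesis
    using assms by (auto simp: poly_lagrange_basis intro!: prod_zero bexI[of _ k])
qed

lemma degree_lagrange_basis:
  assumes "finite I" "i \<in> I"
  shows "degree (lagrange_basis I x i) < card I"
proof -
  have "degree (lagrange_basis I x i)
      \<le> (\<Sum>j\<in>I - {i}. degree (smult (inverse (x i - x j)) [:- x j, 1:]))"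
    unfolding lagrange_basis_def
    using degree_prod_sum_le[of "I - {i}" "\<lambda>j. smult (inverse (x i - x j)) [:- x j, 1:]"] assms(1)
    unfolding o_def by blast
  also have "\<dots> \<le> (\<Sum>j\<in>I - {i}. 1)"
    by (intro sum_mono order.trans[OF degree_smult_le]) simp
  also have "\<dots> < card I"
    using card_Diff1_less[OF assms] by simp
  finally show ?thesis .
qed

text \<open>Both sides have degree below \<open>card I\<close> and agree at the
  \<open>card I\<close> distinct nodes, so they coincide.\<close>

lemma lagrange_interpolation:
  fixes x :: "'i \<Rightarrow> 'a::field"
  assumes "finite I" "inj_on x I" "degree p < card I"
  shows "p = (\<Sum>i\<in>I. smult (poly p (x i)) (lagrange_basis I x i))" (is "p = ?q")
proof (rule poly_eqI_degree[of "x ` I"])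
  fix y assume "y \<in> x ` I"
  then obtain k where "k \<in> I" "y = x k" by blast
  then show "poly p y = poly ?q y"
    using assms by (simp add: poly_sum poly_lagrange_basis_node if_distrib cong: if_cong)
next
  show "card (x ` I) > degree p"
    using assms by (simp add: card_image)
  \<comment> \<open>The strict bound follows from this one since \<open>degree p < card I\<close>
    forces \<open>card I > 0\<close>.\<close>
  have "degree ?q \<le> card I - 1"
  proof (intro degree_sum_le assms(1) order.trans[OF degree_smult_le])
    show "degree (lagrange_basis I x i) \<le> card I - 1" if "i \<in> I" for i
      using degree_lagrange_basis[OF assms(1) that, of x] by linarith
  qed
  then show "card (x ` I) > degree ?q"
    using assms by (simp add: card_image)
qed

text \<open>By linearity it suffices to treat monomials. Since \<open>0 ^ 0 = 1\<close>, the value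
  \<open>0 ^ k\<close> of a monomial at 0 covers the normalisation and the vanishing moments at
  once.\<close>

lemma sum_poly_eq_poly_0_of_moments:
  fixes x c :: "'i \<Rightarrow> 'a::comm_ring_1"
  assumes "\<And>k. k < n \<Longrightarrow> (\<Sum>i\<in>I. c i * x i ^ k) = 0 ^ k" "degree p < n"
  shows "(\<Sum>i\<in>I. c i * poly p (x i)) = poly p 0"
proof -
  have "(\<Sum>i\<in>I. c i * poly p (x i)) = (\<Sum>k\<le>degree p. coeff p k * (\<Sum>i\<in>I. c i * x i ^ k))"
    unfolding poly_altdef sum_distrib_left by (subst sum.swap) (simp add: mult_ac)
  also have "\<dots> = (\<Sum>k\<le>degree p. coeff p k * 0 ^ k)"
    using assms by (intro sum.cong) auto
  finally show ?thesis by (simp add: poly_altdef)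
qed

lemma moments_iff_lagrange_basis_0:
  fixes x c :: "'i \<Rightarrow> 'a::field"
  assumes "finite I" "inj_on x I"
  shows "(\<forall>k<card I. (\<Sum>i\<in>I. c i * x i ^ k) = 0 ^ k)
    \<longleftrightarrow> (\<forall>i\<in>I. c i = poly (lagrange_basis I x i) 0)"
proof (intro iffI ballI allI impI)
  fix i assume moments: "\<forall>k<card I. (\<Sum>i\<in>I. c i * x i ^ k) = 0 ^ k" and i: "i \<in> I"
  have "poly (lagrange_basis I x i) 0 = (\<Sum>k\<in>I. c k * poly (lagrange_basis I x i) (x k))"
    using moments degree_lagrange_basis[OF assms(1) i]
    by (intro sum_poly_eq_poly_0_of_moments[where n = "card I", symmetric]) auto
  \<comment> \<open>The basis polynomial is 1 at its own node and 0 at the others, so only one term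
    survives.\<close>
  also have "\<dots> = c i"
    using assms i by (simp add: poly_lagrange_basis_node if_distrib cong: if_cong)
  finally show "c i = poly (lagrange_basis I x i) 0" ..
next
  fix k assume c: "\<forall>i\<in>I. c i = poly (lagrange_basis I x i) 0" and k: "k < card I"
  \<comment> \<open>Interpolation reproduces the monomial exactly because \<open>k < card I\<close>;
    evaluating at 0 then gives the moment equation.\<close>
  have "monom 1 k = (\<Sum>i\<in>I. smult (x i ^ k) (lagrange_basis I x i))"
    using lagrange_interpolation[OF assms, of "monom 1 k"] k
    by (simp add: degree_monom_eq poly_monom)
  then have "poly (monom 1 k) 0 = poly (\<Sum>i\<in>I. smult (x i ^ k) (lagrange_basis I x i)) 0"
    by simp
  then show "(\<Sum>i\<in>I. c i * x i ^ k) = 0 ^ k"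
    using c by (simp add: poly_sum poly_monom mult.commute)
qed

theorem mainTheorem4:
  fixes r :: nat and h c :: "nat \<Rightarrow> real"
  assumes "r \<ge> 1"
    and "\<And>i. i \<in> {1..r} \<Longrightarrow> h i > 0"
    and "inj_on h {1..r}"
  shows "((\<Sum>i=1..r. c i) = 1 \<and> (\<forall>k\<in>{1..r - 1}. (\<Sum>i=1..r. c i * h i ^ (2 * k)) = 0))
    \<longleftrightarrow> (\<forall>i\<in>{1..r}. c i = (\<Prod>j\<in>{1..r} - {i}. - (h j)\<^sup>2 / ((h i)\<^sup>2 - (h j)\<^sup>2)))"
proof -
  define x where "x = (\<lambda>i. (h i)\<^sup>2)"
  \<comment> \<open>Squaring is injective on positive reals, so the nodes stay distinct.\<close>
  have "inj_on x {1..r}"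
  proof (rule inj_onI)
    fix i j assume ij: "i \<in> {1..r}" "j \<in> {1..r}" "x i = x j"
    then have "h i = h j"
      using assms(2)[of i] assms(2)[of j] by (simp add: x_def)
    then show "i = j"
      using assms(3) ij by (auto dest: inj_onD)
  qed
  then have "(\<forall>k<r. (\<Sum>i=1..r. c i * x i ^ k) = 0 ^ k)
      \<longleftrightarrow> (\<forall>i\<in>{1..r}. c i = poly (lagrange_basis {1..r} x i) 0)"
    using moments_iff_lagrange_basis_0[of "{1..r}" x c] by simp
  moreover have "(\<forall>k<r. (\<Sum>i=1..r. c i * x i ^ k) = 0 ^ k)
      \<longleftrightarrow> (\<Sum>i=1..r. c i) = 1 \<and> (\<forall>k\<in>{1..r - 1}. (\<Sum>i=1..r. c i * x i ^ k) = 0)"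
  proof -
    \<comment> \<open>Here \<open>r \<ge> 1\<close> puts \<open>k = 0\<close> in the range, which
      splits off the normalisation.\<close>
    have "k < r \<longleftrightarrow> k = 0 \<or> k \<in> {1..r - 1}" for k
      using assms(1) by auto
    then have "(\<forall>k<r. P k) \<longleftrightarrow> P 0 \<and> (\<forall>k\<in>{1..r - 1}. P k)" for P
      by metis
    then show ?thesis by (simp add: power_0_left)
  qed
  \<comment> \<open>At 0 each factor has numerator \<open>0 - x j\<close>, which is the
    \<open>- (h j)\<^sup>2\<close> of the claim.\<close>
  ultimately show ?thesis
    by (simp add: poly_lagrange_basis x_def power_mult)
qed

end
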